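(* Let $A_{-1},A_0,A_1$ be nonnegative matrices indexed by $\mathbb{Z}_+\times\mathbb{Z}_+$, let $A_*=A_{-1}+A_0+A_1$, and let \[ Q=\begin{pmatrix} A_0 & A_1 & & & \\ A_{-1} & A_0 & A_1 & & \\ & A_{-1} & A_0 & A_1 & \\ & & \ddots & \ddots & \ddots\end{pmatrix}. \] For $\theta\in\mathbb{R}$ let $A_*(\theta)=e^{-\theta}A_{-1}+A_0+e^{\theta}A_1$ and let $\gamma^\dagger=\inf_{\theta\in\mathbb{R}}\mathrm{cp}(A_*(\theta))^{-1}$. Assume that $Q$ is irreducible and that each row and each column of $A_*$ has only finitely many positive elements. Then \[ \mathrm{cp}(Q)=(\gamma^\dagger)^{-1}=\sup_{\theta\in\mathbb{R}}\mathrm{cp}(A_*(\theta)), \] and $Q$ is $(\gamma^\dagger)^{-1}$-transient.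
   Context: For a nonnegative matrix $A$ of finite or countable dimension, the convergence parameter is $\mathrm{cp}(A)=\sup\{z\in\mathbb{R}_+;\ \sum_{n=0}^\infty z^nA^n<\infty\}$, where "$<\infty$" means that every element is finite; conventions $0^{-1}=\infty$ and $\infty^{-1}=0$ are used. The matrix $Q$ is $\alpha$-transient, where $\alpha=\mathrm{cp}(Q)$, if $\sum_{n=0}^\infty\alpha^nQ^n<\infty$. The entries of $A_{-1},A_0,A_1$ are finite nonnegative reals. $Q$ is regarded as a nonnegative matrix indexed by $\mathbb{Z}_+\times\mathbb{Z}_+$ (level, phase). *)

theory Defs
  imports "HOL-Analysis.Analysis"
begin

text \<open>
  Matrices of finite or countable dimension have real entries and are indexed by a countable type;
  all notions below are meant for matrices with nonnegative entries. Since a row may have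
  infinitely many positive elements, powers take values in \<^typ>\<open>ennreal\<close>. The integral with
  respect to the counting measure is the sum over all indices.
\<close>

primrec mat_power :: "('i::countable \<Rightarrow> 'i \<Rightarrow> real) \<Rightarrow> nat \<Rightarrow> 'i \<Rightarrow> 'i \<Rightarrow> ennreal" where
  "mat_power A 0 = (\<lambda>i j. if i = j then 1 else 0)"
| "mat_power A (Suc n) =
     (\<lambda>i j. \<integral>\<^sup>+ k. ennreal (A i k) * mat_power A n k j \<partial>count_space UNIV)"

definition power_series :: "('i::countable \<Rightarrow> 'i \<Rightarrow> real) \<Rightarrow> ennreal \<Rightarrow> 'i \<Rightarrow> 'i \<Rightarrow> ennreal" where
  "power_series A z i j = (\<Sum>n. z ^ n * mat_power A n i j)"

text \<open>
  The supremum is taken in \<^typ>\<open>ennreal\<close>, so that it is \<open>\<infinity>\<close> for an unbounded set. On this type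
  \<open>inverse 0 = \<infinity>\<close> and \<open>inverse \<infinity> = 0\<close>.
\<close>

definition cp :: "('i::countable \<Rightarrow> 'i \<Rightarrow> real) \<Rightarrow> ennreal" where
  "cp A = Sup {ennreal z | z. 0 \<le> z \<and> (\<forall>i j. power_series A (ennreal z) i j < \<infinity>)}"

definition transient :: "ennreal \<Rightarrow> ('i::countable \<Rightarrow> 'i \<Rightarrow> real) \<Rightarrow> bool" where
  "transient \<alpha> A \<longleftrightarrow> \<alpha> = cp A \<and> (\<forall>i j. power_series A \<alpha> i j < \<infinity>)"

definition irreducible_mat :: "('i::countable \<Rightarrow> 'i \<Rightarrow> real) \<Rightarrow> bool" where
  "irreducible_mat A \<longleftrightarrow> (\<forall>i j. \<exists>n\<ge>1. mat_power A n i j > 0)"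

text \<open>The matrices \<open>Am\<close>, \<open>A0\<close>, \<open>Ap\<close> stand for \<open>A\<^sub>-\<^sub>1\<close>, \<open>A\<^sub>0\<close>, \<open>A\<^sub>1\<close>.\<close>

definition A_star :: "(nat \<Rightarrow> nat \<Rightarrow> real) \<Rightarrow> (nat \<Rightarrow> nat \<Rightarrow> real) \<Rightarrow> (nat \<Rightarrow> nat \<Rightarrow> real)
    \<Rightarrow> nat \<Rightarrow> nat \<Rightarrow> real" where
  "A_star Am A0 Ap i j = Am i j + A0 i j + Ap i j"

definition A_star_at :: "(nat \<Rightarrow> nat \<Rightarrow> real) \<Rightarrow> (nat \<Rightarrow> nat \<Rightarrow> real) \<Rightarrow> (nat \<Rightarrow> nat \<Rightarrow> real)
    \<Rightarrow> real \<Rightarrow> nat \<Rightarrow> nat \<Rightarrow> real" where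
  "A_star_at Am A0 Ap \<theta> i j = exp (- \<theta>) * Am i j + A0 i j + exp \<theta> * Ap i j"

text \<open>Indices are pairs (level, phase); each block row or column belongs to one level.\<close>

definition Q_mat :: "(nat \<Rightarrow> nat \<Rightarrow> real) \<Rightarrow> (nat \<Rightarrow> nat \<Rightarrow> real) \<Rightarrow> (nat \<Rightarrow> nat \<Rightarrow> real)
    \<Rightarrow> nat \<times> nat \<Rightarrow> nat \<times> nat \<Rightarrow> real" where
  "Q_mat Am A0 Ap = (\<lambda>(m, i) (n, j).
     if m = n + 1 then Am i j
     else if n = m then A0 i j
     else if n = m + 1 then Ap i j
     else 0)"

definition gamma_dagger :: "(nat \<Rightarrow> nat \<Rightarrow> real) \<Rightarrow> (nat \<Rightarrow> nat \<Rightarrow> real) \<Rightarrow> (nat \<Rightarrow> nat \<Rightarrow> real)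
    \<Rightarrow> ennreal" where
  "gamma_dagger Am A0 Ap = (INF \<theta>. inverse (cp (A_star_at Am A0 Ap \<theta>)))"

end

theory Submission
  imports Defs "HOL-Complex_Analysis.Great_Picard"
begin

text \<open>
  For an irreducible matrix \<open>A\<close> with \<open>\<alpha> = cp A > 0\<close>, the normalized columns of the Green functions
  \<open>\<Sum>n. z ^ n * A ^ n\<close>, \<open>z < \<alpha>\<close>, have a positive finite lower limit \<open>u\<close> as \<open>z\<close> tends to \<open>\<alpha>\<close>, and
  \<open>\<alpha> * A u \<le> u\<close> by Fatou's lemma. Take such a vector \<open>v\<close> for \<open>Q\<close>. By the inequality between
  arithmetic and geometric means, geometric means of its level shifts are again superharmonic, and
  the Harnack inequality holds uniformly in the level because a path of \<open>Q\<close> can be shifted upwards.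
  Hence the normalized geometric means over the first \<open>N\<close> levels converge along a subsequence, and
  the change from one level to the next is multiplication by a factor \<open>exp \<theta>\<close> that does not depend
  on the phase. The limit is a positive vector \<open>u\<close> with \<open>\<alpha> * A\<^sub>*(\<theta>) u \<le> u\<close>, so that
  \<open>cp (A\<^sub>*(\<theta>)) \<ge> \<alpha>\<close>. Conversely, such a \<open>u\<close> yields the vector \<open>exp (\<theta> * m) * u i\<close> for \<open>Q\<close>, which is
  strictly superharmonic at level 0, where the block \<open>A\<^sub>-\<^sub>1\<close> is missing; this gives transience.
\<close>

section \<open>Matrices acting on vectors, powers, and superharmonic vectors\<close>

definition mat_vec :: "('i::countable \<Rightarrow> 'i \<Rightarrow> real) \<Rightarrow> ('i \<Rightarrow> ennreal) \<Rightarrow> 'i \<Rightarrow> ennreal" where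
  "mat_vec A u i = (\<integral>\<^sup>+ k. ennreal (A i k) * u k \<partial>count_space UNIV)"

text \<open>In the theory of nonnegative matrices these are the \<open>z\<close>-subinvariant
  vectors.\<close>

definition superharmonic :: "ennreal \<Rightarrow> ('i::countable \<Rightarrow> 'i \<Rightarrow> real) \<Rightarrow> ('i \<Rightarrow> ennreal) \<Rightarrow> bool" where
  "superharmonic z A u \<longleftrightarrow> (\<forall>i. z * mat_vec A u i \<le> u i)"

lemma ennreal_finite_of_mult_le:
  fixes a b c :: ennreal
  assumes "a * b \<le> c" and "c < \<infinity>" and "0 < b"
  shows "a < \<infinity>"
proof (rule ccontr)
  assume "\<not> a < \<infinity>"
  then have "a = \<infinity>" by (cases a) auto
  then show False using assms by (auto simp: ennreal_top_mult top_unique zero_less_iff_neq_zero split: if_splits)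
qed

lemma ennreal_power_pos: "0 < z \<Longrightarrow> 0 < (z::ennreal) ^ n"
  by (induction n) (auto simp: ennreal_zero_less_mult_iff)

lemma ennreal_liminf_cmult:
  fixes f :: "nat \<Rightarrow> ennreal"
  shows "c < \<infinity> \<Longrightarrow> liminf (\<lambda>n. c * f n) = c * liminf f"
  by (rule Liminf_compose_continuous_mono)
     (auto intro!: ennreal_continuous_on_cmult continuous_on_id monoI mult_left_mono)

lemma mat_power_Suc_mat_vec: "mat_power A (Suc n) i j = mat_vec A (\<lambda>k. mat_power A n k j) i"
  by (simp add: mat_vec_def)

lemma mat_vec_mono: "(\<And>i. u i \<le> v i) \<Longrightarrow> mat_vec A u i \<le> mat_vec A v i"
  unfolding mat_vec_def by (intro nn_integral_mono mult_left_mono) auto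

lemma mat_vec_cmult: "mat_vec A (\<lambda>k. c * u k) i = c * mat_vec A u i"
  unfolding mat_vec_def by (subst nn_integral_cmult[symmetric]) (auto simp: ac_simps)

lemma mat_vec_mult_right: "mat_vec A (\<lambda>k. u k * c) i = mat_vec A u i * c"
  using mat_vec_cmult[of A c u i] by (simp add: mult.commute)

lemma mat_vec_sum: "mat_vec A (\<lambda>k. \<Sum>n\<in>S. u n k) i = (\<Sum>n\<in>S. mat_vec A (u n) i)"
  unfolding mat_vec_def by (subst nn_integral_sum[symmetric]) (auto simp: sum_distrib_left)

lemma mat_vec_suminf: "mat_vec A (\<lambda>k. \<Sum>n. u n k) i = (\<Sum>n. mat_vec A (u n) i)"
  unfolding mat_vec_def
  by (subst nn_integral_suminf[symmetric]) auto

lemma mat_vec_ge_term: "ennreal (A i j) * u j \<le> mat_vec A u i"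
  unfolding mat_vec_def by (rule nn_integral_ge_point) simp

lemma mat_vec_liminf: "mat_vec A (\<lambda>k. liminf (\<lambda>n. u n k)) i \<le> liminf (\<lambda>n. mat_vec A (u n) i)"
proof -
  have "ennreal (A i k) * liminf (\<lambda>n. u n k) = liminf (\<lambda>n. ennreal (A i k) * u n k)" for k
    by (rule ennreal_liminf_cmult[symmetric]) simp
  then show ?thesis
    unfolding mat_vec_def using nn_integral_liminf[of "\<lambda>n k. ennreal (A i k) * u n k" "count_space UNIV"]
    by simp
qed

lemma mat_power_add:
  "mat_power A (m + n) i j = (\<integral>\<^sup>+ k. mat_power A m i k * mat_power A n k j \<partial>count_space UNIV)"
proof (induction m arbitrary: i)
  case 0
  have "(\<integral>\<^sup>+ k. mat_power A 0 i k * mat_power A n k j \<partial>count_space UNIV)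
      = (\<Sum>k\<in>{i}. mat_power A 0 i k * mat_power A n k j)"
    by (rule nn_integral_count_space') auto
  then show ?case by simp
next
  case (Suc m)
  have "mat_power A (Suc m + n) i j =
      (\<integral>\<^sup>+ k. (\<integral>\<^sup>+ l. ennreal (A i k) * (mat_power A m k l * mat_power A n l j) \<partial>count_space UNIV)
        \<partial>count_space UNIV)"
    by (simp add: Suc nn_integral_cmult)
  also have "\<dots> = (\<integral>\<^sup>+ l. (\<integral>\<^sup>+ k. ennreal (A i k) * (mat_power A m k l * mat_power A n l j) \<partial>count_space UNIV)
        \<partial>count_space UNIV)"
    by (rule nn_integral_count_space_nn_integral) auto
  also have "\<dots> = (\<integral>\<^sup>+ l. mat_power A (Suc m) i l * mat_power A n l j \<partial>count_space UNIV)"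
    by (simp add: nn_integral_multc[symmetric] mult.assoc)
  finally show ?case .
qed

text \<open>Iterate superharmonicity \<open>n\<close> times and keep a single term of the resulting
  sum. Wherever the matrix power is positive this is a Harnack inequality: a path from
  \<open>i\<close> to \<open>j\<close> bounds \<open>u j\<close> in terms of
  \<open>u i\<close>.\<close>

lemma superharmonic_mat_power_le:
  assumes "superharmonic z A u"
  shows "z ^ n * (mat_power A n i j * u j) \<le> u i"
proof (induction n arbitrary: i)
  case 0
  then show ?case by auto
next
  case (Suc n)
  have "z ^ Suc n * (mat_power A (Suc n) i j * u j)
      = z * mat_vec A (\<lambda>k. z ^ n * (mat_power A n k j * u j)) i"
    unfolding mat_power_Suc_mat_vec mat_vec_cmult mat_vec_mult_right by (simp add: ac_simps)
  also have "\<dots> \<le> z * mat_vec A u i"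
    using Suc by (intro mult_left_mono mat_vec_mono) auto
  also have "\<dots> \<le> u i"
    using assms by (simp add: superharmonic_def)
  finally show ?case .
qed

section \<open>Green functions and the convergence parameter\<close>

text \<open>Splitting off \<open>n = 0\<close> and pulling one factor \<open>A\<close> out of the
  remaining terms gives the renewal equation G = I + z A G. A column of G is thus superharmonic,
  with its whole defect at \<open>s\<close>.\<close>

lemma power_series_unfold:
  "power_series A z i s = (if i = s then 1 else 0) + z * mat_vec A (\<lambda>k. power_series A z k s) i"
proof -
  have "power_series A z i s
      = z ^ 0 * mat_power A 0 i s + (\<Sum>n. z ^ Suc n * mat_power A (Suc n) i s)"
    unfolding power_series_def
    using suminf_offset[of "\<lambda>n. z ^ n * mat_power A n i s" 1] by simp
  also have "(\<Sum>n. z ^ Suc n * mat_power A (Suc n) i s)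
      = z * (\<Sum>n. mat_vec A (\<lambda>k. z ^ n * mat_power A n k s) i)"
    unfolding mat_power_Suc_mat_vec mat_vec_cmult ennreal_suminf_cmult[symmetric]
    by (simp add: ac_simps)
  also have "(\<Sum>n. mat_vec A (\<lambda>k. z ^ n * mat_power A n k s) i)
      = mat_vec A (\<lambda>k. power_series A z k s) i"
    unfolding power_series_def by (rule mat_vec_suminf[symmetric])
  finally show ?thesis by simp
qed

text \<open>The partial sums obey the renewal recursion started from 0. As \<open>mat_vec\<close> is
  monotone, they stay below every supersolution with a source of size \<open>w\<close> at
  \<open>s\<close>.\<close>

lemma power_series_minimal:
  assumes "\<And>i. (if i = s then w else 0) + z * mat_vec A u i \<le> u i"
  shows "power_series A z i s * w \<le> u i"
proof -
  have part: "(\<Sum>n<N. z ^ n * mat_power A n i s) * w \<le> u i" for N i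
  proof (induction N arbitrary: i)
    case 0
    then show ?case by simp
  next
    case (Suc N)
    have "(\<Sum>n<Suc N. z ^ n * mat_power A n i s)
        = (if i = s then 1 else 0) + (\<Sum>n<N. z ^ Suc n * mat_power A (Suc n) i s)"
      by (subst sum.lessThan_Suc_shift) simp
    also have "(\<Sum>n<N. z ^ Suc n * mat_power A (Suc n) i s)
        = z * mat_vec A (\<lambda>k. \<Sum>n<N. z ^ n * mat_power A n k s) i"
      unfolding mat_power_Suc_mat_vec mat_vec_sum mat_vec_cmult sum_distrib_left
      by (simp add: ac_simps)
    finally have "(\<Sum>n<Suc N. z ^ n * mat_power A n i s) * w
        = (if i = s then w else 0) + z * mat_vec A (\<lambda>k. (\<Sum>n<N. z ^ n * mat_power A n k s) * w) i"
      unfolding mat_vec_mult_right by (simp add: distrib_right mult.assoc)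
    also have "\<dots> \<le> (if i = s then w else 0) + z * mat_vec A u i"
      using Suc by (intro add_left_mono mult_left_mono mat_vec_mono) auto
    also have "\<dots> \<le> u i"
      by (rule assms)
    finally show ?case .
  qed
  have "power_series A z i s * w = (\<Sum>n. z ^ n * mat_power A n i s * w)"
    unfolding power_series_def by simp
  also have "\<dots> \<le> u i"
    by (rule suminf_le_const) (simp_all add: sum_distrib_right[symmetric] part)
  finally show ?thesis .
qed

text \<open>The positive defect of \<open>u\<close> at \<open>s\<close> acts as the source, so
  \<open>u\<close> dominates a positive multiple of column \<open>s\<close> of the Green
  function.\<close>

lemma power_series_finite_of_strict:
  assumes "superharmonic z A u" and "\<And>i. u i < \<infinity>" and "z * mat_vec A u s < u s"
  shows "power_series A z i s < \<infinity>"
proof -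
  define w where "w = u s - z * mat_vec A u s"
  have "w > 0"
    using assms(3) by (simp add: w_def diff_gt_0_iff_gt_ennreal)
  have "power_series A z i s * w \<le> u i"
  proof (rule power_series_minimal)
    fix i
    have "w + z * mat_vec A u s = u s"
      using assms(3) by (simp add: w_def diff_add_cancel_ennreal less_imp_le)
    then show "(if i = s then w else 0) + z * mat_vec A u i \<le> u i"
      using assms(1) by (auto simp: superharmonic_def)
  qed
  then show ?thesis
    using assms(2) \<open>w > 0\<close> by (rule ennreal_finite_of_mult_le)
qed

lemma power_series_mono:
  assumes "y \<le> z"
  shows "power_series A y i j \<le> power_series A z i j"
  unfolding power_series_def
  by (intro suminf_le mult_right_mono power_mono assms) auto

lemma power_series_finite_below_cp:
  assumes "z < cp A"
  shows "power_series A z i j < \<infinity>"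
proof -
  obtain y where y: "z < ennreal y" "power_series A (ennreal y) i j < \<infinity>"
    using assms unfolding cp_def less_Sup_iff by blast
  have "power_series A z i j \<le> power_series A (ennreal y) i j"
    using y(1) by (intro power_series_mono) auto
  then show ?thesis
    using y(2) by (rule le_less_trans)
qed

lemma cp_geI:
  assumes "z < \<infinity>" and "\<And>i j. power_series A z i j < \<infinity>"
  shows "z \<le> cp A"
proof -
  obtain r where "z = ennreal r" "0 \<le> r"
    using assms(1) by (cases z) auto
  then show ?thesis
    using assms(2) unfolding cp_def by (intro Sup_upper) auto
qed

text \<open>For every \<open>y < z\<close> the vector \<open>u\<close> is strictly superharmonic at
  each index, which makes every column of the Green function at \<open>y\<close> finite. Then
  \<open>y\<close> increases to \<open>z\<close>.\<close>

lemma cp_ge_of_superharmonic: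
  assumes "superharmonic z A u" and "z < \<infinity>" and "\<And>i. 0 < u i" "\<And>i. u i < \<infinity>"
  shows "z \<le> cp A"
proof (rule dense_le)
  fix y assume "y < z"
  show "y \<le> cp A"
  proof (rule cp_geI)
    show "y < \<infinity>"
      using \<open>y < z\<close> assms(2) by auto
    fix i j
    have le: "z * mat_vec A u i \<le> u i" for i
      using assms(1) by (simp add: superharmonic_def)
    have "y * mat_vec A u i \<le> z * mat_vec A u i" for i
      using \<open>y < z\<close> by (intro mult_right_mono) auto
    then have "superharmonic y A u"
      using le by (auto simp: superharmonic_def intro: order_trans)
    moreover have "y * mat_vec A u j < u j"
    proof (cases "mat_vec A u j = 0")
      case True
      then show ?thesis using assms(3) by simp
    next
      case False
      \<comment> \<open>Multiplication by \<infinity> would destroy the strict inequality between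
        positive \<open>y\<close> and \<open>z\<close>.\<close>
      have "mat_vec A u j < \<infinity>"
      proof (rule ennreal_finite_of_mult_le)
        show "mat_vec A u j * z \<le> u j"
          using le[of j] by (simp add: mult.commute)
        show "0 < z"
          using \<open>y < z\<close> by (rule le_less_trans[rotated]) simp
      qed (rule assms(4))
      then have "y * mat_vec A u j < z * mat_vec A u j"
        using False \<open>y < z\<close> by (intro ennreal_mult_strict_right_mono) (simp_all add: zero_less_iff_neq_zero)
      then show ?thesis using le[of j] by simp
    qed
    ultimately show "power_series A y i j < \<infinity>"
      using power_series_finite_of_strict[of y A u j i] assms(4) by blast
  qed
qed

text \<open>Paths from \<open>i\<close> to \<open>j\<close> followed by \<open>k\<close> steps from
  \<open>j\<close> to \<open>s\<close> are among the paths from \<open>i\<close> to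
  \<open>s\<close>; reindexing by \<open>n + k\<close> drops only the first \<open>k\<close> terms
  of the series.\<close>

lemma power_series_mult_mat_power_le:
  "power_series A z i j * (z ^ k * mat_power A k j s) \<le> power_series A z i s"
proof -
  have "power_series A z i j * (z ^ k * mat_power A k j s)
      = (\<Sum>n. z ^ n * mat_power A n i j * (z ^ k * mat_power A k j s))"
    unfolding power_series_def by (rule ennreal_suminf_multc[symmetric])
  also have "\<dots> \<le> (\<Sum>n. z ^ (n + k) * mat_power A (n + k) i s)"
  proof (intro suminf_le)
    fix n
    have "mat_power A n i j * mat_power A k j s \<le> mat_power A (n + k) i s"
      unfolding mat_power_add by (rule nn_integral_ge_point) simp
    then have "z ^ (n + k) * (mat_power A n i j * mat_power A k j s) \<le> z ^ (n + k) * mat_power A (n + k) i s"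
      by (rule mult_left_mono) simp
    then show "z ^ n * mat_power A n i j * (z ^ k * mat_power A k j s) \<le> z ^ (n + k) * mat_power A (n + k) i s"
      by (simp add: power_add ac_simps)
  qed auto
  also have "\<dots> \<le> power_series A z i s"
    unfolding power_series_def
    by (subst suminf_offset[of "\<lambda>n. z ^ n * mat_power A n i s" k]) auto
  finally show ?thesis .
qed

section \<open>Irreducible matrices and a superharmonic vector at the convergence parameter\<close>

lemma irreducible_matD:
  assumes "irreducible_mat A"
  obtains n where "mat_power A n i j > 0"
  using assms unfolding irreducible_mat_def by blast

text \<open>A path from \<open>j\<close> to \<open>s\<close> bounds column \<open>j\<close> by a
  multiple of column \<open>s\<close>, so one finite column suffices.\<close>

lemma irreducible_transientI:
  assumes "irreducible_mat A" and "0 < z" and "\<And>i. power_series A z i s < \<infinity>"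
  shows "power_series A z i j < \<infinity>"
proof -
  obtain k where k: "mat_power A k j s > 0"
    using irreducible_matD[OF assms(1)] by blast
  have "0 < z ^ k * mat_power A k j s"
    using k assms(2) by (simp add: ennreal_zero_less_mult_iff ennreal_power_pos)
  then show ?thesis
    using ennreal_finite_of_mult_le[OF power_series_mult_mat_power_le[of A z i j k s] assms(3)[of i]]
    by blast
qed

lemma superharmonic_power_series: "superharmonic z A (\<lambda>i. power_series A z i s)"
  unfolding superharmonic_def by (subst (2) power_series_unfold) (simp add: add_increasing)

lemma power_series_self_ge_1: "1 \<le> power_series A z s s"
  by (subst power_series_unfold) (simp add: add_increasing2)

text \<open>A closed path at \<open>s\<close> of length \<open>k \<ge> 1\<close> has positive
  weight. Harnack's inequality for column \<open>s\<close> of a finite Green function, applied from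
  \<open>s\<close> to itself, bounds \<open>z ^ k\<close> times this weight by 1, so
  \<open>z\<close> cannot be arbitrarily large.\<close>

lemma irreducible_cp_finite:
  fixes A :: "'i::countable \<Rightarrow> 'i \<Rightarrow> real"
  assumes "irreducible_mat A"
  shows "cp A < \<infinity>"
proof (rule ccontr)
  assume "\<not> cp A < \<infinity>"
  then have cp: "z < cp A" if "z < \<infinity>" for z
    using that by (simp add: not_less top_unique)
  fix s :: 'i
  obtain k where k: "k \<ge> 1" "mat_power A k s s > 0"
    using assms unfolding irreducible_mat_def by blast
  have le: "z ^ k * mat_power A k s s \<le> 1" if "z < \<infinity>" for z
  proof -
    define g where "g = power_series A z s s"
    have g: "g < \<infinity>" "0 < g"
      using power_series_finite_below_cp[OF cp[OF that]] power_series_self_ge_1[of A z s]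
      by (auto simp: g_def intro: less_le_trans[of 0 1])
    have "z ^ k * mat_power A k s s * g \<le> 1 * g"
      using superharmonic_mat_power_le[OF superharmonic_power_series[of z A s], of k s s]
      by (simp add: g_def mult.assoc)
    then show ?thesis
      using ennreal_mult_le_mult_iff[of g "z ^ k * mat_power A k s s" 1] g
      by (simp add: mult.commute zero_less_iff_neq_zero)
  qed
  have "mat_power A k s s < \<infinity>"
    using le[of 1] by (auto intro: le_less_trans)
  then obtain r where r: "mat_power A k s s = ennreal r" "0 < r"
    using k(2) by (cases "mat_power A k s s") auto
  have "r \<le> 1"
    using le[of 1] r by simp
  \<comment> \<open>With base at least 1 and \<open>k \<ge> 1\<close>, the power
    \<open>(2 / r) ^ k\<close> is at least \<open>2 / r\<close>, so its product with
    \<open>r\<close> exceeds the bound 1.\<close>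
  then have "2 / r \<ge> 1"
    using r by (simp add: field_simps)
  then have "(2 / r) ^ 1 \<le> (2 / r) ^ k"
    using k(1) by (intro power_increasing) auto
  then have "2 \<le> (2 / r) ^ k * r"
    using r by (simp add: field_simps)
  moreover have "ennreal ((2 / r) ^ k * r) \<le> 1"
    using le[of "ennreal (2 / r)"] r by (simp add: ennreal_power ennreal_mult)
  ultimately show False
    by simp
qed

text \<open>The Green function may diverge at \<open>cp A\<close> itself, so its columns are scaled
  to have value 1 at \<open>s\<close> before the limit is taken. Harnack's inequality along paths to
  and from \<open>s\<close> keeps the lower limit positive and finite.\<close>

theorem irreducible_cp_superharmonic:
  fixes A :: "'i::countable \<Rightarrow> 'i \<Rightarrow> real"
  assumes irr: "irreducible_mat A" and pos: "0 < cp A"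
  obtains u where "superharmonic (cp A) A u" "\<And>i. 0 < u i" "\<And>i. u i < \<infinity>"
proof -
  obtain y where y: "0 < y" "y < cp A"
    using dense[OF pos] by blast
  obtain x where x: "\<And>n. x n < cp A" "x \<longlonglongrightarrow> cp A"
    using approx_from_below_dense_linorder[OF y(2)] by blast
  \<comment> \<open>The maximum with the fixed \<open>y > 0\<close> makes the Harnack constants
    below independent of \<open>n\<close>.\<close>
  define z where "z n = max y (x n)" for n
  have z: "\<And>n. y \<le> z n" "\<And>n. z n < cp A"
    using x(1) y(2) by (auto simp: z_def)
  have "z \<longlonglongrightarrow> max y (cp A)"
    unfolding z_def by (intro tendsto_max tendsto_const x)
  then have z_lim: "z \<longlonglongrightarrow> cp A"
    using y(2) by (simp add: max_absorb2)
  fix s :: 'i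
  define c where "c n = inverse (power_series A (z n) s s)" for n
  define v where "v n i = power_series A (z n) i s * c n" for n i
  define u where "u i = liminf (\<lambda>n. v n i)" for i
  have g: "0 < power_series A (z n) s s" "power_series A (z n) s s < \<infinity>" for n
    using power_series_finite_below_cp[OF z(2)] power_series_self_ge_1[of A "z n" s]
    by (auto intro: less_le_trans[of 0 1])
  have vs: "v n s = 1" for n
    using g[of n] by (simp add: v_def c_def divide_ennreal_def[symmetric])
  have super: "superharmonic (z n) A (v n)" for n
    using superharmonic_power_series[of "z n" A s] unfolding superharmonic_def v_def mat_vec_mult_right
    by (auto simp: mult.assoc[symmetric] intro: mult_right_mono)
  have harnack: "y ^ k * mat_power A k i j * v n j \<le> v n i" for k i j n
  proof -
    have "y ^ k * mat_power A k i j * v n j \<le> z n ^ k * (mat_power A k i j * v n j)"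
      unfolding mult.assoc using z(1)[of n] by (intro mult_right_mono power_mono) auto
    also have "\<dots> \<le> v n i"
      by (rule superharmonic_mat_power_le[OF super])
    finally show ?thesis .
  qed
  have u_pos: "0 < u i" for i
  proof -
    obtain k where k: "mat_power A k i s > 0"
      using irreducible_matD[OF irr] by blast
    have "y ^ k * mat_power A k i s \<le> u i"
      unfolding u_def using harnack[of k i s] by (intro Liminf_bounded) (simp add: vs)
    then show ?thesis
      using k y(1) by (auto simp: ennreal_zero_less_mult_iff ennreal_power_pos intro: less_le_trans[rotated])
  qed
  have u_fin: "u i < \<infinity>" for i
  proof -
    obtain k where k: "mat_power A k s i > 0"
      using irreducible_matD[OF irr] by blast
    define d where "d = y ^ k * mat_power A k s i"
    have "0 < d"
      using k y(1) by (simp add: d_def ennreal_zero_less_mult_iff ennreal_power_pos)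
    have le: "d * v n i \<le> 1" for n
      using harnack[of k s i n] by (simp add: d_def vs)
    \<comment> \<open>A path in the opposite direction makes \<open>v 0 i\<close> positive. This
      forces \<open>d\<close> to be finite, as is required to move it through the lower
      limit.\<close>
    obtain l where l: "mat_power A l i s > 0"
      using irreducible_matD[OF irr] by blast
    have "0 < y ^ l * mat_power A l i s"
      using l y(1) by (simp add: ennreal_zero_less_mult_iff ennreal_power_pos)
    then have "0 < v 0 i"
      using harnack[of l i s 0] by (simp add: vs)
    then have "d < \<infinity>"
      using ennreal_finite_of_mult_le[OF le[of 0]] by simp
    then have "d * u i = liminf (\<lambda>n. d * v n i)"
      unfolding u_def by (rule ennreal_liminf_cmult[symmetric])
    also have "\<dots> \<le> liminf (\<lambda>n. 1)"
      using le by (intro Liminf_mono) simp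
    finally have "u i * d \<le> 1"
      by (simp add: Liminf_const mult.commute)
    then show ?thesis
      by (rule ennreal_finite_of_mult_le) (use \<open>0 < d\<close> in auto)
  qed
  have "superharmonic (cp A) A u"
    unfolding superharmonic_def
  proof
    fix i
    \<comment> \<open>Two limits are taken one after the other: with \<open>n\<close> fixed,
      \<open>z n\<close> is eventually below \<open>z m\<close> and Fatou's lemma applies in
      \<open>m\<close>; only afterwards does \<open>n\<close> tend to infinity.\<close>
    have le: "z n * mat_vec A u i \<le> u i" for n
    proof -
      have "z n < \<infinity>"
        using z(2)[of n] by (auto intro: less_le_trans)
      have "z n * mat_vec A u i \<le> z n * liminf (\<lambda>m. mat_vec A (v m) i)"
        unfolding u_def by (intro mult_left_mono mat_vec_liminf) simp
      also have "\<dots> = liminf (\<lambda>m. z n * mat_vec A (v m) i)"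
        using \<open>z n < \<infinity>\<close> by (rule ennreal_liminf_cmult[symmetric])
      also have "\<dots> \<le> liminf (\<lambda>m. v m i)"
      proof (rule Liminf_mono)
        have "eventually (\<lambda>m. z n < z m) sequentially"
          using z_lim z(2) by (rule order_tendstoD(1))
        then show "eventually (\<lambda>m. z n * mat_vec A (v m) i \<le> v m i) sequentially"
        proof eventually_elim
          case (elim m)
          have "z n * mat_vec A (v m) i \<le> z m * mat_vec A (v m) i"
            using elim by (intro mult_right_mono) auto
          also have "\<dots> \<le> v m i"
            using super by (simp add: superharmonic_def)
          finally show ?case .
        qed
      qed
      finally show ?thesis by (simp add: u_def)
    qed
    have "0 < z 0"
      using y(1) z(1)[of 0] by simp
    have "mat_vec A u i < \<infinity>"
      using le[of 0] u_fin[of i] \<open>0 < z 0\<close>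
      by (subst (asm) mult.commute) (rule ennreal_finite_of_mult_le)
    then have "(\<lambda>n. mat_vec A u i * z n) \<longlonglongrightarrow> mat_vec A u i * cp A"
      using z_lim by (intro ennreal_tendsto_cmult) auto
    then show "cp A * mat_vec A u i \<le> u i"
      using le by (intro LIMSEQ_le_const2[of _ "cp A * mat_vec A u i"]) (auto simp: mult.commute)
  qed
  then show ?thesis
    using u_pos u_fin that by blast
qed

section \<open>Geometric means of solutions of exponential inequalities\<close>

text \<open>The averaged exponents are the logarithms of geometric means of superharmonic vectors.\<close>

lemma sum_exp_average_le:
  fixes c :: "'t \<Rightarrow> real" and x :: "nat \<Rightarrow> 't \<Rightarrow> real" and b :: "nat \<Rightarrow> real"
  assumes "finite T" and "0 < N" and c: "\<And>t. t \<in> T \<Longrightarrow> 0 \<le> c t"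
    and le: "\<And>k. k < N \<Longrightarrow> (\<Sum>t\<in>T. c t * exp (x k t)) \<le> exp (b k)"
  shows "(\<Sum>t\<in>T. c t * exp ((\<Sum>k<N. x k t) / N)) \<le> exp ((\<Sum>k<N. b k) / N)"
proof -
  \<comment> \<open>Dividing the \<open>k\<close>-th inequality by \<open>exp (b k)\<close> turns
    its right-hand side into 1. The arithmetic mean over \<open>k\<close> keeps this bound and, by
    convexity of exp, dominates the geometric mean.\<close>
  define B where "B = (\<Sum>k<N. b k) / N"
  have jensen: "exp ((\<Sum>k<N. x k t) / N - B) \<le> (\<Sum>k<N. exp (x k t - b k)) / N" for t
  proof -
    have "exp (\<Sum>k<N. (1 / N) *\<^sub>R (x k t - b k)) \<le> (\<Sum>k<N. (1 / N) * exp (x k t - b k))"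
      by (rule convex_on_sum[OF _ _ exp_convex]) (use \<open>0 < N\<close> in auto)
    then show ?thesis
      by (simp add: B_def sum_divide_distrib sum_subtractf diff_divide_distrib)
  qed
  have "(\<Sum>t\<in>T. c t * exp ((\<Sum>k<N. x k t) / N - B))
      \<le> (\<Sum>t\<in>T. c t * ((\<Sum>k<N. exp (x k t - b k)) / N))"
    by (intro sum_mono mult_left_mono jensen c)
  also have "\<dots> = (\<Sum>k<N. (\<Sum>t\<in>T. c t * exp (x k t)) / exp (b k)) / N"
    by (simp add: sum_distrib_left sum_divide_distrib exp_diff) (rule sum.swap)
  also have "\<dots> \<le> (\<Sum>k<N. 1) / N"
    using le by (intro divide_right_mono sum_mono) auto
  also have "\<dots> = 1"
    using \<open>0 < N\<close> by simp
  finally have "(\<Sum>t\<in>T. c t * exp ((\<Sum>k<N. x k t) / N)) / exp B \<le> 1"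
    by (simp add: exp_diff sum_divide_distrib)
  then show ?thesis
    by (simp add: B_def)
qed

section \<open>The block structure of \<open>Q\<close> and shifts of levels\<close>

lemma mat_vec_Q_mat:
  "mat_vec (Q_mat Am A0 Ap) v (m, i) =
    (\<integral>\<^sup>+ j. (if m = 0 then 0 else ennreal (Am i j) * v (m - 1, j)) + ennreal (A0 i j) * v (m, j)
        + ennreal (Ap i j) * v (m + 1, j) \<partial>count_space UNIV)"
proof -
  have "mat_vec (Q_mat Am A0 Ap) v (m, i)
      = (\<integral>\<^sup>+ j. (\<integral>\<^sup>+ n. ennreal (Q_mat Am A0 Ap (m, i) (n, j)) * v (n, j) \<partial>count_space UNIV)
          \<partial>count_space UNIV)"
    unfolding mat_vec_def by (rule nn_integral_snd_count_space[symmetric])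
  also have "\<dots> = (\<integral>\<^sup>+ j. (if m = 0 then 0 else ennreal (Am i j) * v (m - 1, j))
      + ennreal (A0 i j) * v (m, j) + ennreal (Ap i j) * v (m + 1, j) \<partial>count_space UNIV)"
  proof (intro nn_integral_cong)
    fix j
    have "(\<integral>\<^sup>+ n. ennreal (Q_mat Am A0 Ap (m, i) (n, j)) * v (n, j) \<partial>count_space UNIV)
        = (\<Sum>n\<in>{m - 1, m, m + 1}. ennreal (Q_mat Am A0 Ap (m, i) (n, j)) * v (n, j))"
      by (rule nn_integral_count_space') (auto simp: Q_mat_def)
    \<comment> \<open>For \<open>m = 0\<close> the truncated difference \<open>m - 1\<close> is
      \<open>m\<close> itself, so the set has only two levels and no term with \<open>Am\<close>
      arises.\<close>
    also have "\<dots> = (if m = 0 then 0 else ennreal (Am i j) * v (m - 1, j))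
        + ennreal (A0 i j) * v (m, j) + ennreal (Ap i j) * v (m + 1, j)"
      by (cases m) (auto simp: Q_mat_def add.assoc)
    finally show "(\<integral>\<^sup>+ n. ennreal (Q_mat Am A0 Ap (m, i) (n, j)) * v (n, j) \<partial>count_space UNIV) = \<dots>" .
  qed
  finally show ?thesis .
qed

text \<open>The rows of \<open>Q\<close> repeat from level to level, except that level 0 lacks the
  block \<open>Am\<close>. Moving level \<open>k\<close> down to level 0 can therefore only remove
  nonnegative terms.\<close>

lemma superharmonic_Q_mat_shift:
  assumes "superharmonic z (Q_mat Am A0 Ap) v"
  shows "superharmonic z (Q_mat Am A0 Ap) (\<lambda>(m, i). v (m + k, i))"
  unfolding superharmonic_def
proof safe
  fix m i
  have "mat_vec (Q_mat Am A0 Ap) (\<lambda>(m, i). v (m + k, i)) (m, i) \<le> mat_vec (Q_mat Am A0 Ap) v (m + k, i)"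
    unfolding mat_vec_Q_mat by (intro nn_integral_mono add_mono) auto
  then have "z * mat_vec (Q_mat Am A0 Ap) (\<lambda>(m, i). v (m + k, i)) (m, i)
      \<le> z * mat_vec (Q_mat Am A0 Ap) v (m + k, i)"
    by (rule mult_left_mono) simp
  also have "\<dots> \<le> v (m + k, i)"
    using assms by (simp add: superharmonic_def)
  finally show "z * mat_vec (Q_mat Am A0 Ap) (\<lambda>(m, i). v (m + k, i)) (m, i) \<le> v (m + k, i)" .
qed

section \<open>Exponential vectors and the bound of \<open>cp (A\<theta> \<theta>)\<close> by
  \<open>cp Q\<close>\<close>

locale qbd =
  fixes Am A0 Ap :: "nat \<Rightarrow> nat \<Rightarrow> real"
  assumes nonneg: "\<And>i j. 0 \<le> Am i j" "\<And>i j. 0 \<le> A0 i j" "\<And>i j. 0 \<le> Ap i j"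
begin

abbreviation "Q \<equiv> Q_mat Am A0 Ap"
abbreviation "A\<theta> \<equiv> A_star_at Am A0 Ap"

lemma ennreal_A_star_at:
  "ennreal (A\<theta> \<theta> i j)
    = ennreal (exp (- \<theta>)) * ennreal (Am i j) + ennreal (A0 i j) + ennreal (exp \<theta>) * ennreal (Ap i j)"
  by (simp add: A_star_at_def nonneg ennreal_mult)

text \<open>A step of one level changes the exponential by a factor \<open>exp \<theta>\<close> or
  \<open>exp (- \<theta>)\<close>, which are the weights of the blocks in
  \<open>A\<theta> \<theta>\<close>. The added term makes up for the block missing at level 0; it is
  the later source of transience.\<close>

lemma mat_vec_Q_exp:
  fixes \<theta> :: real and u :: "nat \<Rightarrow> ennreal"
  defines "v \<equiv> (\<lambda>(m, j). ennreal (exp (\<theta> * real m)) * u j)"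
  shows "mat_vec Q v (m, i) + (if m = 0 then ennreal (exp (- \<theta>)) * mat_vec Am u i else 0)
    = ennreal (exp (\<theta> * real m)) * mat_vec (A\<theta> \<theta>) u i"
proof -
  have "mat_vec Q v (m, i) + (if m = 0 then ennreal (exp (- \<theta>)) * mat_vec Am u i else 0)
      = (\<integral>\<^sup>+ j. ((if m = 0 then 0 else ennreal (Am i j) * v (m - 1, j)) + ennreal (A0 i j) * v (m, j)
        + ennreal (Ap i j) * v (m + 1, j))
        + (if m = 0 then ennreal (exp (- \<theta>)) * (ennreal (Am i j) * u j) else 0) \<partial>count_space UNIV)"
    unfolding mat_vec_Q_mat
    by (subst nn_integral_add) (auto simp: mat_vec_def nn_integral_cmult)
  also have "\<dots> = (\<integral>\<^sup>+ j. ennreal (exp (\<theta> * real m)) * (ennreal (A\<theta> \<theta> i j) * u j) \<partial>count_space UNIV)"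
  proof (intro nn_integral_cong)
    fix j
    have up: "ennreal (exp (\<theta> * real (m + 1))) = ennreal (exp (\<theta> * real m)) * ennreal (exp \<theta>)"
      by (simp add: ennreal_mult[symmetric] exp_add[symmetric] algebra_simps)
    have down: "ennreal (exp (\<theta> * real (m - 1))) = ennreal (exp (\<theta> * real m)) * ennreal (exp (- \<theta>))"
      if "m \<noteq> 0"
      using that by (simp add: ennreal_mult[symmetric] exp_add[symmetric] algebra_simps)
    show "((if m = 0 then 0 else ennreal (Am i j) * v (m - 1, j)) + ennreal (A0 i j) * v (m, j)
        + ennreal (Ap i j) * v (m + 1, j))
        + (if m = 0 then ennreal (exp (- \<theta>)) * (ennreal (Am i j) * u j) else 0)
        = ennreal (exp (\<theta> * real m)) * (ennreal (A\<theta> \<theta> i j) * u j)"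
    proof (cases "m = 0")
      case True
      then show ?thesis
        unfolding ennreal_A_star_at by (simp add: v_def distrib_left distrib_right ac_simps)
    next
      case False
      then show ?thesis
        unfolding ennreal_A_star_at v_def prod.case up down[OF False]
        by (simp add: distrib_left distrib_right ac_simps)
    qed
  qed
  also have "\<dots> = ennreal (exp (\<theta> * real m)) * mat_vec (A\<theta> \<theta>) u i"
    unfolding mat_vec_def by (rule nn_integral_cmult) simp
  finally show ?thesis .
qed

lemma mat_vec_Q_exp_le:
  "mat_vec Q (\<lambda>(m, j). ennreal (exp (\<theta> * real m)) * u j) (m, i)
    \<le> ennreal (exp (\<theta> * real m)) * mat_vec (A\<theta> \<theta>) u i"
  unfolding mat_vec_Q_exp[symmetric] by simp

lemma superharmonic_Q_exp:
  assumes "superharmonic z (A\<theta> \<theta>) u"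
  shows "superharmonic z Q (\<lambda>(m, j). ennreal (exp (\<theta> * real m)) * u j)"
  unfolding superharmonic_def
proof safe
  fix m i
  have "z * mat_vec Q (\<lambda>(m, j). ennreal (exp (\<theta> * real m)) * u j) (m, i)
      \<le> z * (ennreal (exp (\<theta> * real m)) * mat_vec (A\<theta> \<theta>) u i)"
    by (intro mult_left_mono mat_vec_Q_exp_le) simp
  also have "\<dots> = ennreal (exp (\<theta> * real m)) * (z * mat_vec (A\<theta> \<theta>) u i)"
    by (simp add: ac_simps)
  also have "\<dots> \<le> ennreal (exp (\<theta> * real m)) * u i"
    using assms by (intro mult_left_mono) (auto simp: superharmonic_def)
  finally show "z * mat_vec Q (\<lambda>(m, j). ennreal (exp (\<theta> * real m)) * u j) (m, i)
      \<le> ennreal (exp (\<theta> * real m)) * u i" .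
qed

text \<open>A column of the Green function of \<open>A\<theta> \<theta>\<close>, multiplied by the
  exponential of the level, is a supersolution for \<open>Q\<close> and hence dominates a multiple
  of a column of the Green function of \<open>Q\<close>.\<close>

lemma cp_A_star_at_le_cp_Q: "cp (A\<theta> \<theta>) \<le> cp Q"
proof (rule dense_le)
  fix z assume z: "z < cp (A\<theta> \<theta>)"
  show "z \<le> cp Q"
  proof (rule cp_geI)
    show "z < \<infinity>"
      using z by (auto intro: less_le_trans)
    fix x y :: "nat \<times> nat"
    obtain m i n s where xy: "x = (m, i)" "y = (n, s)"
      by (cases x, cases y) auto
    define u where "u i = power_series (A\<theta> \<theta>) z i s" for i
    define v where "v = (\<lambda>(m, j). ennreal (exp (\<theta> * real m)) * u j)"
    have "power_series Q z x y * ennreal (exp (\<theta> * real n)) \<le> v x"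
    proof (rule power_series_minimal)
      fix x' :: "nat \<times> nat"
      obtain k l where kl: "x' = (k, l)"
        by (cases x') auto
      have "z * mat_vec Q v (k, l) \<le> z * (ennreal (exp (\<theta> * real k)) * mat_vec (A\<theta> \<theta>) u l)"
        unfolding v_def by (intro mult_left_mono mat_vec_Q_exp_le) simp
      moreover have "v (k, l) = ennreal (exp (\<theta> * real k)) * (if l = s then 1 else 0)
          + z * (ennreal (exp (\<theta> * real k)) * mat_vec (A\<theta> \<theta>) u l)"
        unfolding v_def prod.case u_def
        by (subst power_series_unfold) (simp add: distrib_left ac_simps)
      \<comment> \<open>The product vector has a source at phase \<open>s\<close> on every level;
        the single source at \<open>y\<close> is one of them.\<close>
      moreover have "(if (k, l) = y then ennreal (exp (\<theta> * real n)) else 0)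
          \<le> ennreal (exp (\<theta> * real k)) * (if l = s then 1 else 0)"
        by (auto simp: xy)
      ultimately show "(if x' = y then ennreal (exp (\<theta> * real n)) else 0) + z * mat_vec Q v x' \<le> v x'"
        unfolding kl by (simp only: add_mono)
    qed
    moreover have "v x < \<infinity>"
      using power_series_finite_below_cp[OF z]
      by (simp add: v_def xy u_def ennreal_mult_less_top)
    ultimately show "power_series Q z x y < \<infinity>"
      by (rule ennreal_finite_of_mult_le) simp
  qed
qed

end

section \<open>Irreducible \<open>Q\<close>: transience and the choice of the exponent\<close>

locale irreducible_qbd = qbd +
  assumes irreducible: "irreducible_mat (Q_mat Am A0 Ap)"
    and finite_rows: "\<And>i. finite {j. A_star Am A0 Ap i j > 0}"
begin

lemma A_star_zeroD:
  assumes "j \<notin> {j. A_star Am A0 Ap i j > 0}"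
  shows "Am i j = 0" "A0 i j = 0" "Ap i j = 0"
  using assms nonneg(1)[of i j] nonneg(2)[of i j] nonneg(3)[of i j] unfolding A_star_def by auto

text \<open>If \<open>Am\<close> vanished, no path could lead from a positive level down to level
  0.\<close>

lemma Am_nonzero: obtains i j where "0 < Am i j"
proof (rule ccontr)
  assume "\<not> thesis"
  then have Am: "Am i j = 0" for i j
    using that nonneg(1)[of i j] by (auto simp: order.order_iff_strict)
  have "mat_power Q n (Suc m, i) (0, j) = 0" for n m i j
  proof (induction n arbitrary: m i)
    case (Suc n)
    have "mat_vec Q (\<lambda>k. mat_power Q n k (0, j)) (Suc m, i) = 0"
      unfolding mat_vec_Q_mat by (simp add: Am Suc)
    then show ?case unfolding mat_power_Suc_mat_vec .
  qed simp
  then show False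
    using irreducible_matD[OF irreducible, of "(1, 0)" "(0, 0)"] by (metis One_nat_def less_numeral_extra(3))
qed

text \<open>At level 0 the exponential vector has a positive defect in a phase \<open>i\<close>
  where row \<open>i\<close> of \<open>Am\<close> is nonzero. This makes column
  \<open>(0, i)\<close> finite, and irreducibility extends finiteness to all columns.\<close>

lemma Q_transientI:
  assumes "superharmonic z (A\<theta> \<theta>) u" and "0 < z" and "\<And>i. 0 < u i" and "\<And>i. u i < \<infinity>"
  shows "power_series Q z x y < \<infinity>"
proof -
  define v where "v = (\<lambda>(m, j). ennreal (exp (\<theta> * real m)) * u j)"
  obtain i j where ij: "0 < Am i j"
    by (rule Am_nonzero)
  have "0 < ennreal (Am i j) * u j"
    using ij assms(3) by (simp add: ennreal_zero_less_mult_iff)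
  then have "0 < mat_vec Am u i"
    using mat_vec_ge_term[of Am i j u] by (rule less_le_trans)
  then have pos: "0 < z * (ennreal (exp (- \<theta>)) * mat_vec Am u i)"
    using assms(2) by (simp add: ennreal_zero_less_mult_iff)
  have super: "superharmonic z Q v"
    unfolding v_def by (rule superharmonic_Q_exp[OF assms(1)])
  have fin: "v k < \<infinity>" for k
    using assms(4) by (auto simp: v_def ennreal_mult_less_top split: prod.splits)
  have "z * mat_vec Q v (0, i) + z * (ennreal (exp (- \<theta>)) * mat_vec Am u i) \<le> v (0, i)"
    using assms(1) mat_vec_Q_exp[of \<theta> u 0 i]
    by (simp add: v_def superharmonic_def distrib_left[symmetric])
  moreover have "z * mat_vec Q v (0, i) < \<infinity>"
    using super fin[of "(0, i)"] by (auto simp: superharmonic_def intro: le_less_trans)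
  ultimately have "z * mat_vec Q v (0, i) < v (0, i)"
    using pos by (metis add.right_neutral ennreal_add_left_cancel_less infinity_ennreal_def less_le_trans)
  then have "power_series Q z k (0, i) < \<infinity>" for k
    using super fin by (intro power_series_finite_of_strict[of z Q v]) auto
  then show ?thesis
    by (rule irreducible_transientI[OF irreducible assms(2)])
qed

text \<open>One fixed path from \<open>(d, j)\<close> to \<open>(e, i)\<close> yields the constant.
  Applying it to the shifted vectors makes \<open>C\<close> independent of \<open>k\<close>.\<close>

lemma superharmonic_Q_harnack:
  fixes v :: "nat \<times> nat \<Rightarrow> ennreal"
  assumes super: "superharmonic \<alpha> Q v" and \<alpha>: "0 < \<alpha>"
    and v_pos: "\<And>x. 0 < v x" and v_fin: "\<And>x. v x < \<infinity>"
  obtains C where "\<And>k. ln (enn2real (v (k + e, i))) \<le> ln (enn2real (v (k + d, j))) + C"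
proof -
  obtain n where n: "mat_power Q n (d, j) (e, i) > 0"
    using irreducible_matD[OF irreducible] by blast
  define c where "c = \<alpha> ^ n * mat_power Q n (d, j) (e, i)"
  have le: "c * v (k + e, i) \<le> v (k + d, j)" for k
    using superharmonic_mat_power_le[OF superharmonic_Q_mat_shift[OF super, of k], of n "(d, j)" "(e, i)"]
    by (simp add: c_def mult.assoc add.commute)
  have "0 < c"
    using n \<alpha> by (simp add: c_def ennreal_zero_less_mult_iff ennreal_power_pos)
  moreover have "c < \<infinity>"
    using ennreal_finite_of_mult_le[OF le[of 0] v_fin v_pos] .
  ultimately obtain r where r: "c = ennreal r" "0 < r"
    by (cases c) auto
  have "ln (enn2real (v (k + e, i))) \<le> ln (enn2real (v (k + d, j))) + (- ln r)" for k
  proof -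
    obtain a where a: "v (k + e, i) = ennreal a" "0 < a"
      using v_pos[of "(k + e, i)"] v_fin[of "(k + e, i)"] by (cases "v (k + e, i)") auto
    obtain b where b: "v (k + d, j) = ennreal b" "0 < b"
      using v_pos[of "(k + d, j)"] v_fin[of "(k + d, j)"] by (cases "v (k + d, j)") auto
    have "r * a \<le> b"
      using le[of k] r a b by (simp add: ennreal_mult[symmetric])
    then have "ln (r * a) \<le> ln b"
      using r a b by simp
    then show ?thesis
      using r a b by (simp add: ln_mult)
  qed
  then show ?thesis
    by (rule that)
qed

theorem A_star_at_superharmonic:
  fixes \<alpha> :: real
  assumes super: "superharmonic (ennreal \<alpha>) Q v" and \<alpha>: "0 < \<alpha>"
    and v_pos: "\<And>x. 0 < v x" and v_fin: "\<And>x. v x < \<infinity>"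
  obtains \<theta> u where "superharmonic (ennreal \<alpha>) (A\<theta> \<theta>) u" "\<And>i. 0 < u i" "\<And>i. u i < \<infinity>"
proof -
  define L where "L m j = ln (enn2real (v (m, j)))" for m j
  have v_eq: "v (m, j) = ennreal (exp (L m j))" for m j
    using v_pos[of "(m, j)"] v_fin[of "(m, j)"] by (cases "v (m, j)") (auto simp: L_def)
  have "\<exists>C. \<forall>k. \<bar>L (k + d) j - L (k + e) i\<bar> \<le> C" for d j e i
  proof -
    obtain C1 where C1: "\<And>k. L (k + e) i \<le> L (k + d) j + C1"
      using superharmonic_Q_harnack[OF super _ v_pos v_fin, of e i d j] \<alpha> unfolding L_def by auto
    obtain C2 where C2: "\<And>k. L (k + d) j \<le> L (k + e) i + C2"
      using superharmonic_Q_harnack[OF super _ v_pos v_fin, of d j e i] \<alpha> unfolding L_def by auto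
    have "\<bar>L (k + d) j - L (k + e) i\<bar> \<le> max C1 C2" for k
      using C1[of k] C2[of k] by linarith
    then show ?thesis by blast
  qed
  then obtain C where C: "\<And>d j e i k. \<bar>L (k + d) j - L (k + e) i\<bar> \<le> C d j e i"
    by metis
  define S where "S i = {j. A_star Am A0 Ap i j > 0}" for i
  \<comment> \<open>The offsets 0, 1, 2 replace -1, 0, 1: row level \<open>k + 1\<close> reaches the
    levels \<open>k + d\<close>, and being positive it contains all three blocks.\<close>
  define B where "B d = (if d = 0 then Am else if d = 1 then A0 else Ap)" for d :: nat
  define T where "T i = {0, 1, 2::nat} \<times> S i" for i
  have T_fin: "finite (T i)" for i
    using finite_rows by (simp add: T_def S_def)
  have sum_T: "(\<Sum>(d, j)\<in>T i. f d j) = (\<Sum>j\<in>S i. f 0 j + f 1 j + f 2 j)"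
    for f :: "nat \<Rightarrow> nat \<Rightarrow> real" and i
    unfolding T_def by (simp add: sum.cartesian_product[symmetric] sum.distrib)
  have B_nonneg: "0 \<le> B d i j" for d i j
    by (simp add: B_def nonneg)
  have le: "(\<Sum>(d, j)\<in>T i. \<alpha> * B d i j * exp (L (k + d) j)) \<le> exp (L (k + 1) i)" for k i
  proof -
    have "mat_vec Q v (k + 1, i)
        = (\<Sum>j\<in>S i. ennreal (Am i j) * v (k, j) + ennreal (A0 i j) * v (k + 1, j)
            + ennreal (Ap i j) * v (k + 2, j))"
      unfolding mat_vec_Q_mat using finite_rows
      by (subst nn_integral_count_space'[where A = "S i"]) (auto simp: S_def A_star_zeroD)
    also have "\<dots> = ennreal (\<Sum>j\<in>S i. Am i j * exp (L k j) + A0 i j * exp (L (k + 1) j)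
            + Ap i j * exp (L (k + 2) j))"
      by (subst sum_ennreal[symmetric]) (auto simp: v_eq nonneg ennreal_mult)
    also have "(\<Sum>j\<in>S i. Am i j * exp (L k j) + A0 i j * exp (L (k + 1) j) + Ap i j * exp (L (k + 2) j))
        = (\<Sum>(d, j)\<in>T i. B d i j * exp (L (k + d) j))"
      unfolding sum_T by (simp add: B_def)
    finally have "ennreal (\<alpha> * (\<Sum>(d, j)\<in>T i. B d i j * exp (L (k + d) j))) \<le> ennreal (exp (L (k + 1) i))"
      using super[unfolded superharmonic_def, rule_format, of "(k + 1, i)"] \<alpha>
      by (simp add: v_eq ennreal_mult')
    then show ?thesis
      by (simp add: sum_distrib_left case_prod_unfold mult.assoc)
  qed
  \<comment> \<open>\<open>d = 1\<close> stands for the reference level, \<open>d = 0\<close> and \<open>d = 2\<close> for the levels below and above.\<close>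
  define h where "h N d j = (\<Sum>k<N. L (k + d) j - L (k + 1) 0) / real N" for N d j
  \<comment> \<open>Subtracting \<open>L (k + 1) 0\<close> divides both sides of \<open>le\<close>
    by the same number, so the inequality survives. With this normalization the averages stay
    bounded in \<open>N\<close>.\<close>
  have h_le: "(\<Sum>(d, j)\<in>T i. \<alpha> * B d i j * exp (h N d j)) \<le> exp (h N 1 i)" if "0 < N" for N i
  proof -
    have "(\<Sum>t\<in>T i. (case t of (d, j) \<Rightarrow> \<alpha> * B d i j)
          * exp ((\<Sum>k<N. case t of (d, j) \<Rightarrow> L (k + d) j - L (k + 1) 0) / real N))
        \<le> exp ((\<Sum>k<N. L (k + 1) i - L (k + 1) 0) / real N)"
    proof (rule sum_exp_average_le[OF T_fin that])
      show "0 \<le> (case t of (d, j) \<Rightarrow> \<alpha> * B d i j)" for t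
        using \<alpha> B_nonneg by (auto split: prod.splits)
      fix k
      have "(\<Sum>(d, j)\<in>T i. \<alpha> * B d i j * exp (L (k + d) j)) / exp (L (k + 1) 0)
          \<le> exp (L (k + 1) i) / exp (L (k + 1) 0)"
        by (intro divide_right_mono le) simp
      then show "(\<Sum>t\<in>T i. (case t of (d, j) \<Rightarrow> \<alpha> * B d i j)
          * exp (case t of (d, j) \<Rightarrow> L (k + d) j - L (k + 1) 0)) \<le> exp (L (k + 1) i - L (k + 1) 0)"
        by (simp add: sum_divide_distrib case_prod_unfold exp_diff)
    qed
    then show ?thesis
      by (simp add: h_def case_prod_unfold)
  qed
  have h_bound: "\<bar>h N d j\<bar> \<le> C d j 1 0" for N d j
  proof (cases "N = 0")
    case True
    then show ?thesis
      using C[of 0 d j 1 0] by (simp add: h_def)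
  next
    case False
    have "\<bar>\<Sum>k<N. L (k + d) j - L (k + 1) 0\<bar> \<le> (\<Sum>k<N. C d j 1 0)"
      using C by (intro order_trans[OF sum_abs] sum_mono)
    then show ?thesis
      using False by (simp add: h_def field_simps)
  qed
  \<comment> \<open>Scaling to the common bound 1 permits a diagonal argument giving one subsequence
    for all offsets and phases; the summand 1 keeps the divisor positive.\<close>
  define f where "f N x = h N (fst x) (snd x) / (C (fst x) (snd x) 1 0 + 1)" for N x
  have C_pos: "0 < C d j 1 0 + 1" for d j
    using C[of 0 d j 1 0] by linarith
  have "norm (f N x) \<le> 1" for N x
    using h_bound[of N "fst x" "snd x"] C_pos[of "fst x" "snd x"] by (simp add: f_def)
  then obtain r :: "nat \<Rightarrow> nat" where r: "strict_mono r" and f_lim: "\<And>x. \<exists>l. (\<lambda>n. f (r n) x) \<longlonglongrightarrow> l"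
    using function_convergent_subsequence[of UNIV f 1] by (metis UNIV_I countableI_type)
  have "\<exists>l. (\<lambda>n. h (r n) d j) \<longlonglongrightarrow> l" for d j
  proof -
    obtain l where "(\<lambda>n. f (r n) (d, j)) \<longlonglongrightarrow> l"
      using f_lim by blast
    then have "(\<lambda>n. f (r n) (d, j) * (C d j 1 0 + 1)) \<longlonglongrightarrow> l * (C d j 1 0 + 1)"
      by (intro tendsto_mult_right)
    then show ?thesis
      using C_pos[of d j] by (auto simp: f_def)
  qed
  then obtain H where H: "\<And>d j. (\<lambda>n. h (r n) d j) \<longlonglongrightarrow> H d j"
    by metis
  \<comment> \<open>The normalizing terms cancel and the difference of the two sums
    telescopes.\<close>
  have h_Suc: "h N (Suc d) j - h N d j = (L (N + d) j - L d j) / real N" for N d j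
  proof -
    have "(\<Sum>k<N. L (k + Suc d) j - L (k + 1) 0) - (\<Sum>k<N. L (k + d) j - L (k + 1) 0)
        = (\<Sum>k<N. L (Suc k + d) j - L (k + d) j)"
      by (simp add: sum_subtractf)
    also have "\<dots> = L (N + d) j - L d j"
      using sum_lessThan_telescope[of "\<lambda>k. L (k + d) j" N] by simp
    finally show ?thesis
      by (simp add: h_def diff_divide_distrib[symmetric])
  qed
  \<comment> \<open>The limiting logarithmic growth per level, read off at phase 0.\<close>
  define \<theta> where "\<theta> = H 1 0 - H 0 0"
  have H_Suc: "H (Suc d) j - H d j = \<theta>" for d j
  proof -
    \<comment> \<open>By Harnack's inequality phases \<open>j\<close> and 0 differ by at most
      \<open>C d j 0 0\<close>, once at shift \<open>N\<close> and once at shift 0. Divided by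
      \<open>N\<close>, the discrepancy vanishes in the limit, so every phase has the same
      growth.\<close>
    have bound: "norm ((h N (Suc d) j - h N d j) - (h N 1 0 - h N 0 0)) \<le> 2 * C d j 0 0 * (1 / real N)" for N
    proof -
      have "\<bar>(L (N + d) j - L d j) - (L N 0 - L 0 0)\<bar> \<le> 2 * C d j 0 0"
        using C[of N d j 0 0] C[of 0 d j 0 0] by simp
      then show ?thesis
        using h_Suc[of N d j] h_Suc[of N 0 0]
        by (simp add: diff_divide_distrib[symmetric] divide_right_mono)
    qed
    have "(\<lambda>N. (h N (Suc d) j - h N d j) - (h N 1 0 - h N 0 0)) \<longlonglongrightarrow> 0"
    proof (rule Lim_null_comparison)
      show "(\<lambda>N. 2 * C d j 0 0 * (1 / real N)) \<longlonglongrightarrow> 0"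
        using tendsto_mult_right_zero[OF lim_1_over_n] .
    qed (use bound in simp)
    then have "(\<lambda>n. (h (r n) (Suc d) j - h (r n) d j) - (h (r n) 1 0 - h (r n) 0 0)) \<longlonglongrightarrow> 0"
      by (rule filterlim_compose[OF _ filterlim_subseq[OF r]])
    moreover have "(\<lambda>n. (h (r n) (Suc d) j - h (r n) d j) - (h (r n) 1 0 - h (r n) 0 0))
        \<longlonglongrightarrow> (H (Suc d) j - H d j) - \<theta>"
      unfolding \<theta>_def by (intro tendsto_diff H)
    ultimately show ?thesis
      using LIMSEQ_unique by fastforce
  qed
  have H0: "H 0 j = H 1 j - \<theta>" and H2: "H 2 j = H 1 j + \<theta>" for j
    using H_Suc[of 0 j] H_Suc[of 1 j] by (simp_all add: numeral_2_eq_2)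
  define u where "u j = ennreal (exp (H 1 j))" for j
  have limit: "(\<Sum>(d, j)\<in>T i. \<alpha> * B d i j * exp (H d j)) \<le> exp (H 1 i)" for i
  proof (rule LIMSEQ_le)
    show "(\<lambda>n. \<Sum>(d, j)\<in>T i. \<alpha> * B d i j * exp (h (r n) d j))
        \<longlonglongrightarrow> (\<Sum>(d, j)\<in>T i. \<alpha> * B d i j * exp (H d j))"
      unfolding case_prod_unfold by (intro tendsto_intros H)
    show "(\<lambda>n. exp (h (r n) 1 i)) \<longlonglongrightarrow> exp (H 1 i)"
      by (intro tendsto_intros H)
    have "0 < r n" if "1 \<le> n" for n
      using seq_suble[OF r, of n] that by simp
    then show "\<exists>N. \<forall>n\<ge>N. (\<Sum>(d, j)\<in>T i. \<alpha> * B d i j * exp (h (r n) d j)) \<le> exp (h (r n) 1 i)"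
      using h_le by blast
  qed
  have "superharmonic (ennreal \<alpha>) (A\<theta> \<theta>) u"
    unfolding superharmonic_def
  proof
    fix i
    have "mat_vec (A\<theta> \<theta>) u i = (\<Sum>j\<in>S i. ennreal (A\<theta> \<theta> i j) * u j)"
      unfolding mat_vec_def using finite_rows
      by (subst nn_integral_count_space'[where A = "S i"]) (auto simp: S_def A_star_at_def A_star_zeroD)
    also have "\<dots> = ennreal (\<Sum>j\<in>S i. A\<theta> \<theta> i j * exp (H 1 j))"
      by (subst sum_ennreal[symmetric]) (auto simp: u_def A_star_at_def nonneg ennreal_mult)
    \<comment> \<open>Replacing \<open>H 0\<close> and \<open>H 2\<close> by \<open>H 1\<close>
      minus and plus \<open>\<theta>\<close> turns the three blocks into
      \<open>A\<theta> \<theta>\<close>.\<close>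
    also have "(\<Sum>j\<in>S i. A\<theta> \<theta> i j * exp (H 1 j)) = (\<Sum>(d, j)\<in>T i. B d i j * exp (H d j))"
      unfolding sum_T H0 H2 by (simp add: B_def A_star_at_def exp_diff exp_add exp_minus field_simps)
    finally have "ennreal \<alpha> * mat_vec (A\<theta> \<theta>) u i
        = ennreal (\<Sum>(d, j)\<in>T i. \<alpha> * B d i j * exp (H d j))"
      using \<alpha> by (simp add: ennreal_mult'[symmetric] sum_distrib_left case_prod_unfold mult.assoc)
    then show "ennreal \<alpha> * mat_vec (A\<theta> \<theta>) u i \<le> u i"
      using limit[of i] by (simp add: u_def)
  qed
  then show ?thesis
    by (rule that) (simp_all add: u_def)
qed

text \<open>The exponent obtained from a superharmonic vector of \<open>Q\<close> at
  \<open>cp Q\<close> attains the supremum, and the accompanying \<open>u\<close> also gives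
  transience.\<close>

lemma ex_cp_A_star_at_eq_cp_Q:
  assumes "0 < cp Q"
  shows "(\<exists>\<theta>. cp (A\<theta> \<theta>) = cp Q) \<and> (\<forall>x y. power_series Q (cp Q) x y < \<infinity>)"
proof -
  have fin: "cp Q < \<infinity>"
    by (rule irreducible_cp_finite[OF irreducible])
  then obtain \<alpha> where \<alpha>: "cp Q = ennreal \<alpha>" "0 < \<alpha>"
    using assms by (cases "cp Q") auto
  obtain v where v: "superharmonic (cp Q) Q v" "\<And>x. 0 < v x" "\<And>x. v x < \<infinity>"
    using irreducible_cp_superharmonic[OF irreducible assms] by blast
  obtain \<theta> u where u: "superharmonic (cp Q) (A\<theta> \<theta>) u" "\<And>i. 0 < u i" "\<And>i. u i < \<infinity>"
    using A_star_at_superharmonic[of \<alpha> v] v \<alpha> by metis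
  have "cp Q \<le> cp (A\<theta> \<theta>)"
    by (rule cp_ge_of_superharmonic[OF u(1) fin u(2,3)])
  then show ?thesis
    using cp_A_star_at_le_cp_Q[of \<theta>] Q_transientI[OF u(1) assms u(2,3)] by (auto intro: antisym)
qed

lemma cp_Q_eq_SUP: "cp Q = (SUP \<theta>. cp (A\<theta> \<theta>))"
proof (rule antisym)
  show "cp Q \<le> (SUP \<theta>. cp (A\<theta> \<theta>))"
  proof (cases "0 < cp Q")
    case True
    then show ?thesis
      using ex_cp_A_star_at_eq_cp_Q by (metis SUP_upper UNIV_I)
  qed simp
  show "(SUP \<theta>. cp (A\<theta> \<theta>)) \<le> cp Q"
    by (intro SUP_least cp_A_star_at_le_cp_Q)
qed

lemma transient_Q: "transient (cp Q) Q"
proof (cases "0 < cp Q")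
  case True
  then show ?thesis
    using ex_cp_A_star_at_eq_cp_Q by (simp add: transient_def)
next
  case False
  then have "cp Q = 0"
    by simp
  \<comment> \<open>At 0 the renewal equation leaves only the identity matrix.\<close>
  moreover have "power_series Q 0 x y < \<infinity>" for x y
    by (subst power_series_unfold) simp
  ultimately show ?thesis
    by (simp add: transient_def)
qed

end

section \<open>Reciprocals of infima, and the conclusion\<close>

lemma ennreal_inverse_inverse: "inverse (inverse a) = (a::ennreal)"
proof (cases a)
  case (real r)
  then show ?thesis
    by (cases "r = 0") (auto simp: inverse_ennreal)
qed simp

lemma ennreal_inverse_antimono:
  fixes a b :: ennreal
  assumes "a \<le> b"
  shows "inverse b \<le> inverse a"
proof (cases "a = 0 \<or> b = top")
  case False
  then obtain r s where "a = ennreal r" "b = ennreal s" "0 < r" "0 < s"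
    using assms by (cases a; cases b) (auto simp: less_le top_unique)
  then show ?thesis
    using assms by (auto simp: inverse_ennreal)
qed auto

text \<open>Inversion is an order-reversing involution of \<open>ennreal\<close>, so it exchanges
  infima and suprema.\<close>

lemma inverse_INF_inverse:
  fixes f :: "'a \<Rightarrow> ennreal"
  shows "inverse (INF i\<in>I. inverse (f i)) = (SUP i\<in>I. f i)"
proof (rule antisym)
  have "inverse (SUP i\<in>I. f i) \<le> (INF i\<in>I. inverse (f i))"
    by (intro INF_greatest ennreal_inverse_antimono SUP_upper)
  then show "inverse (INF i\<in>I. inverse (f i)) \<le> (SUP i\<in>I. f i)"
    using ennreal_inverse_antimono ennreal_inverse_inverse by metis
  show "(SUP i\<in>I. f i) \<le> inverse (INF i\<in>I. inverse (f i))"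
    by (intro SUP_least) (metis INF_lower ennreal_inverse_antimono ennreal_inverse_inverse)
qed

theorem lemma2p6:
  fixes Am A0 Ap :: "nat \<Rightarrow> nat \<Rightarrow> real"
  assumes "\<And>i j. 0 \<le> Am i j" and "\<And>i j. 0 \<le> A0 i j" and "\<And>i j. 0 \<le> Ap i j"
    and "irreducible_mat (Q_mat Am A0 Ap)"
    and "\<And>i. finite {j. A_star Am A0 Ap i j > 0}"
    and "\<And>j. finite {i. A_star Am A0 Ap i j > 0}"
  shows "cp (Q_mat Am A0 Ap) = inverse (gamma_dagger Am A0 Ap)
    \<and> inverse (gamma_dagger Am A0 Ap) = (SUP \<theta>. cp (A_star_at Am A0 Ap \<theta>))
    \<and> transient (inverse (gamma_dagger Am A0 Ap)) (Q_mat Am A0 Ap)"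
proof -
  interpret irreducible_qbd Am A0 Ap
    by unfold_locales (use assms in auto)
  have "inverse (gamma_dagger Am A0 Ap) = (SUP \<theta>. cp (A_star_at Am A0 Ap \<theta>))"
    unfolding gamma_dagger_def by (rule inverse_INF_inverse)
  then show ?thesis
    using cp_Q_eq_SUP transient_Q by simp
qed

end
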